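(* For every integer $n\ge 7$ there exists a CDCC graph $\Gamma_n$ with $n$ vertices such that $I(\Gamma_n)^s$ has linear quotients for all $s\ge 2$.
   Context: A finite simple graph $\Gamma$ is a CDCC graph if it is gapfree (for any two disjoint edges $e,e'$ there is an edge meeting both) and contains each of the following as an induced subgraph: a cricket (a vertex adjacent to four other vertices, with exactly one additional edge, joining two of those four), a diamond (the complete graph on four vertices with one edge removed), the $4$-cycle $C_4$, and the $5$-cycle $C_5$. $I(\Gamma)$ is the edge ideal of $\Gamma$ in a polynomial ring over a field with one variable per vertex, generated by the products of the variables of the endpoints of each edge. A monomial ideal generated in a single degree has linear quotients if its minimal monomial generators can be ordered $u_1>\cdots>u_r$ so that each colon ideal $(u_1,\ldots,u_i):u_{i+1}$, $1\le i<r$, is generated by a subset of the variables. *)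

theory Defs
  imports Main "HOL-Library.Multiset"
begin

definition simple_graph :: "'a set \<Rightarrow> 'a set set \<Rightarrow> bool" where
  "simple_graph V E \<longleftrightarrow> finite V \<and> (\<forall>e\<in>E. e \<subseteq> V \<and> card e = 2)"

definition adj :: "'a set set \<Rightarrow> 'a \<Rightarrow> 'a \<Rightarrow> bool" where
  "adj E x y \<longleftrightarrow> {x, y} \<in> E"

definition gapfree :: "'a set set \<Rightarrow> bool" where
  "gapfree E \<longleftrightarrow> (\<forall>e\<in>E. \<forall>e'\<in>E. e \<inter> e' = {} \<longrightarrow>
      (\<exists>f\<in>E. f \<inter> e \<noteq> {} \<and> f \<inter> e' \<noteq> {}))"

definition has_induced :: "'a set \<Rightarrow> 'a set set \<Rightarrow> 'b set \<Rightarrow> 'b set set \<Rightarrow> bool" where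
  "has_induced V E HV HE \<longleftrightarrow> (\<exists>f. inj_on f HV \<and> f ` HV \<subseteq> V \<and>
      (\<forall>x\<in>HV. \<forall>y\<in>HV. x \<noteq> y \<longrightarrow> (adj E (f x) (f y) \<longleftrightarrow> {x, y} \<in> HE)))"

definition cricket_edges :: "nat set set" where
  "cricket_edges = {{0,1},{0,2},{0,3},{0,4},{1,2}}"

definition diamond_edges :: "nat set set" where
  "diamond_edges = {{0,1},{0,2},{0,3},{1,2},{1,3}}"

definition C4_edges :: "nat set set" where
  "C4_edges = {{0,1},{1,2},{2,3},{3,0}}"

definition C5_edges :: "nat set set" where
  "C5_edges = {{0,1},{1,2},{2,3},{3,4},{4,0}}"

definition CDCC :: "'a set \<Rightarrow> 'a set set \<Rightarrow> bool" where
  "CDCC V E \<longleftrightarrow> simple_graph V E \<and> gapfree E \<and>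
     has_induced V E {0..<5} cricket_edges \<and>
     has_induced V E {0..<4} diamond_edges \<and>
     has_induced V E {0..<4} C4_edges \<and>
     has_induced V E {0..<5} C5_edges"

(* Monomials in the variables V are multisets over V (exponent vectors).
   Monomial ideals are identified with their sets of monomials. *)
definition mon_ideal :: "'a set \<Rightarrow> 'a multiset set \<Rightarrow> 'a multiset set" where
  "mon_ideal V G = {m. set_mset m \<subseteq> V \<and> (\<exists>g\<in>G. g \<subseteq># m)}"

definition colon :: "'a set \<Rightarrow> 'a multiset set \<Rightarrow> 'a multiset \<Rightarrow> 'a multiset set" where
  "colon V I u = {m. set_mset m \<subseteq> V \<and> m + u \<in> I}"

definition edge_mon :: "'a set \<Rightarrow> 'a multiset" where
  "edge_mon e = mset_set e"

definition power_gens :: "'a set set \<Rightarrow> nat \<Rightarrow> 'a multiset set" where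
  "power_gens E s = {m. \<exists>es. length es = s \<and> set es \<subseteq> E \<and> m = sum_list (map edge_mon es)}"

definition min_gens :: "'a multiset set \<Rightarrow> 'a multiset set" where
  "min_gens G = {u\<in>G. \<not> (\<exists>v\<in>G. v \<subseteq># u \<and> v \<noteq> u)}"

definition linear_quotients :: "'a set \<Rightarrow> 'a multiset set \<Rightarrow> bool" where
  "linear_quotients V G \<longleftrightarrow> (\<exists>us. distinct us \<and> set us = min_gens G \<and>
     (\<forall>i. 1 \<le> i \<and> i < length us \<longrightarrow>
        (\<exists>S\<subseteq>V. colon V (mon_ideal V (set (take i us))) (us ! i)
                  = mon_ideal V ((\<lambda>x. {#x#}) ` S))))"

end

theory Submission
  imports Defs "HOL-Library.List_Lexorder" "HOL-Library.Product_Lexorder"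
begin

text \<open>
  The graph is the wheel over the 5-cycle with one rim vertex replaced by \<open>n - 5\<close> pairwise non-adjacent twins.
  A monomial is a product of \<open>s\<close> edges of such a blow-up iff its image under the projection is a product of \<open>s\<close>
  edges of the wheel, so an order witnessing linear quotients for the wheel lifts by breaking ties
  lexicographically inside the twin class.
  For the wheel, the generators of the \<open>s\<close>-th power are the integer points of an explicit polytope, and a slight
  modification of a reverse lexicographic order works uniformly in \<open>s \<ge> 2\<close>: whenever \<open>v\<close> precedes \<open>u\<close>, some
  generator \<open>u x/y\<close> with \<open>deg\<^sub>x v > deg\<^sub>x u\<close> also precedes \<open>u\<close>. This is a statement of linear integer arithmetic
  in the exponents.
\<close>

section \<open>Linear quotients from an exchange property\<close>

lemma mset_subset_eq_same_size:
  assumes "A \<subseteq># B" "size A = size B"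
  shows "A = B"
  using assms by (metis mset_subset_size nat_neq_iff subset_mset.less_le)

lemma min_gens_equigenerated:
  assumes "\<And>u. u \<in> G \<Longrightarrow> size u = d"
  shows "min_gens G = G"
proof -
  have "v = u" if "u \<in> G" "v \<in> G" "v \<subseteq># u" for u v
    using that assms by (metis mset_subset_eq_same_size)
  then show ?thesis unfolding min_gens_def by blast
qed

text \<open>List the generators by increasing key. If \<open>v\<close> precedes \<open>u\<close> and
  divides the product of \<open>m\<close> and \<open>u\<close>, then an \<open>x\<close> with larger
  exponent in \<open>v\<close> than in \<open>u\<close> must divide \<open>m\<close>; conversely
  such an \<open>x\<close> takes \<open>u\<close> to a multiple of the earlier generator
  \<open>u x/y\<close>. So these \<open>x\<close> generate the colon ideal.\<close>

lemma linear_quotients_by_key: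
  fixes key :: "'a multiset \<Rightarrow> 'k::linorder"
  assumes fin: "finite G" and deg: "\<And>u. u \<in> G \<Longrightarrow> size u = d"
    and vars: "\<And>u. u \<in> G \<Longrightarrow> set_mset u \<subseteq> V" and inj: "inj_on key G"
    and exchange: "\<And>u v. u \<in> G \<Longrightarrow> v \<in> G \<Longrightarrow> key v < key u \<Longrightarrow>
      \<exists>x y. count u x < count v x \<and> y \<in># u \<and> add_mset x (u - {#y#}) \<in> G \<and>
        key (add_mset x (u - {#y#})) < key u"
  shows "linear_quotients V G"
proof -
  define ks where "ks = sorted_list_of_set (key ` G)"
  define us where "us = map (inv_into G key) ks"
  have ks: "set ks = key ` G" "sorted ks" "distinct ks"
    using fin by (auto simp: ks_def)
  have key_us: "map key us = ks"
    using ks(1) by (auto simp: us_def f_inv_into_f intro: map_idI)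
  have set_us: "set us = G"
    using ks(1) inj by (simp add: us_def inv_into_image_cancel image_comp)
  have "distinct us"
    using ks(3) key_us by (metis distinct_map)
  have prefix: "set (take i us) = {v \<in> G. key v < key (us ! i)}" if "i < length us" for i
  proof -
    have len: "length ks = length us" by (simp add: us_def)
    have nth: "key (us ! j) = ks ! j" if "j < length us" for j
      using key_us that by (metis nth_map)
    have "ks ! j < ks ! i \<longleftrightarrow> j < i" if "j < length us" for j
      using ks(2,3) that \<open>i < length us\<close> len
      by (metis linorder_not_less order_less_le nth_eq_iff_index_eq sorted_nth_mono linorder_le_cases)
    then show ?thesis
      using that nth set_us[symmetric]
      by (auto simp: in_set_conv_nth set_eq_iff) (metis order.strict_trans)
  qed
  have "\<exists>S\<subseteq>V. colon V (mon_ideal V (set (take i us))) (us ! i) = mon_ideal V ((\<lambda>x. {#x#}) ` S)"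
    if i: "i < length us" for i
  proof -
    define u where "u = us ! i"
    have u: "u \<in> G" using i set_us by (auto simp: u_def)
    define S where "S = {x. \<exists>y. y \<in># u \<and> add_mset x (u - {#y#}) \<in> G \<and>
        key (add_mset x (u - {#y#})) < key u}"
    have "S \<subseteq> V" using vars by (fastforce simp: S_def)
    have "(\<exists>v. v \<in> G \<and> key v < key u \<and> v \<subseteq># m + u) \<longleftrightarrow> (\<exists>x\<in>S. x \<in># m)" for m
    proof
      assume "\<exists>v. v \<in> G \<and> key v < key u \<and> v \<subseteq># m + u"
      then obtain v where v: "v \<in> G" "key v < key u" "v \<subseteq># m + u" by blast
      from exchange[OF u v(1,2)] obtain x where x: "count u x < count v x" "x \<in> S"
        by (auto simp: S_def)
      have "count v x \<le> count m x + count u x"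
        using v(3) by (metis count_union mset_subset_eq_count)
      then show "\<exists>x\<in>S. x \<in># m"
        using x by (metis add_0 count_eq_zero_iff linorder_not_less)
    next
      assume "\<exists>x\<in>S. x \<in># m"
      then obtain x y where "x \<in># m" "y \<in># u" and w: "add_mset x (u - {#y#}) \<in> G"
        "key (add_mset x (u - {#y#})) < key u" by (auto simp: S_def)
      moreover have "add_mset x (u - {#y#}) \<subseteq># m + u"
        using \<open>x \<in># m\<close> subset_mset.add_mono[of "{#x#}" m "u - {#y#}" u] by simp
      ultimately show "\<exists>v. v \<in> G \<and> key v < key u \<and> v \<subseteq># m + u" by blast
    qed
    then have "colon V (mon_ideal V (set (take i us))) u = mon_ideal V ((\<lambda>x. {#x#}) ` S)"
      using vars[OF u] unfolding colon_def mon_ideal_def prefix[OF i] u_def[symmetric]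
      by auto
    with \<open>S \<subseteq> V\<close> show ?thesis unfolding u_def by blast
  qed
  then show ?thesis
    unfolding linear_quotients_def using \<open>distinct us\<close> set_us min_gens_equigenerated[OF deg] by blast
qed

section \<open>Products of \<open>s\<close> edges\<close>

lemma power_gens_0: "power_gens E 0 = {{#}}"
  by (auto simp: power_gens_def)

lemma in_power_gens_Suc:
  "m \<in> power_gens E (Suc s) \<longleftrightarrow> (\<exists>e\<in>E. \<exists>m'\<in>power_gens E s. m = edge_mon e + m')"
proof
  assume "m \<in> power_gens E (Suc s)"
  then obtain e es where "e \<in> E" "length es = s" "set es \<subseteq> E" "m = edge_mon e + sum_list (map edge_mon es)"
    by (auto simp: power_gens_def length_Suc_conv)
  then show "\<exists>e\<in>E. \<exists>m'\<in>power_gens E s. m = edge_mon e + m'"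
    unfolding power_gens_def by blast
next
  assume "\<exists>e\<in>E. \<exists>m'\<in>power_gens E s. m = edge_mon e + m'"
  then obtain e es where "e \<in> E" "length es = s" "set es \<subseteq> E" "m = edge_mon e + sum_list (map edge_mon es)"
    by (auto simp: power_gens_def)
  then show "m \<in> power_gens E (Suc s)"
    by (auto simp: power_gens_def intro!: exI[of _ "e # es"])
qed

lemma finite_power_gens:
  assumes "finite E"
  shows "finite (power_gens E s)"
proof (induction s)
  case (Suc s)
  have "power_gens E (Suc s) \<subseteq> (\<lambda>(e, m). edge_mon e + m) ` (E \<times> power_gens E s)"
    by (auto simp: in_power_gens_Suc)
  then show ?case using Suc assms finite_subset by blast
qed (simp add: power_gens_0)

lemma size_power_gens:
  assumes "\<And>e. e \<in> E \<Longrightarrow> card e = 2" "m \<in> power_gens E s"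
  shows "size m = 2 * s"
  using assms(2) by (induction s arbitrary: m) (auto simp: power_gens_0 in_power_gens_Suc edge_mon_def assms(1))

lemma edge_mon_doubleton: "x \<noteq> y \<Longrightarrow> edge_mon {x, y} = {#x, y#}"
  by (simp add: edge_mon_def)

section \<open>Blow-ups\<close>

text \<open>When every member of \<open>F\<close> has two elements, no edge lies inside a fibre of
  \<open>\<phi>\<close>, so the vertices of a fibre are pairwise non-adjacent twins.\<close>

definition blowup :: "'a set \<Rightarrow> ('a \<Rightarrow> 'b) \<Rightarrow> 'b set set \<Rightarrow> 'a set set" where
  "blowup V \<phi> F = {{x, y} | x y. x \<in> V \<and> y \<in> V \<and> {\<phi> x, \<phi> y} \<in> F}"

text \<open>Adjacency depends only on the images under \<open>\<phi>\<close>. An edge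
  \<open>{a, b}\<close> split off from the projected monomial therefore lifts to
  \<open>{x, y}\<close> for any factors \<open>x\<close>, \<open>y\<close> of \<open>m\<close> above
  \<open>a\<close>, \<open>b\<close>.\<close>

lemma power_gens_blowup:
  assumes F: "\<And>e. e \<in> F \<Longrightarrow> card e = 2"
  shows "power_gens (blowup V \<phi> F) s = {m. set_mset m \<subseteq> V \<and> image_mset \<phi> m \<in> power_gens F s}"
proof (induction s)
  case 0
  then show ?case by (auto simp: power_gens_0)
next
  case (Suc s)
  have ne: "\<phi> x \<noteq> \<phi> y" if "{\<phi> x, \<phi> y} \<in> F" for x y
    using F[OF that] by auto
  show ?case
  proof (intro equalityI subsetI)
    fix m assume "m \<in> power_gens (blowup V \<phi> F) (Suc s)"
    then obtain x y m' where m': "x \<in> V" "y \<in> V" "{\<phi> x, \<phi> y} \<in> F"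
        "set_mset m' \<subseteq> V" "image_mset \<phi> m' \<in> power_gens F s" and m: "m = edge_mon {x, y} + m'"
      unfolding in_power_gens_Suc blowup_def Suc[unfolded blowup_def] by blast
    have "x \<noteq> y" using ne[OF m'(3)] by auto
    then have "m = {#x, y#} + m'" "image_mset \<phi> m = edge_mon {\<phi> x, \<phi> y} + image_mset \<phi> m'"
      using m ne[OF m'(3)] by (auto simp: edge_mon_doubleton)
    then show "m \<in> {m. set_mset m \<subseteq> V \<and> image_mset \<phi> m \<in> power_gens F (Suc s)}"
      using m' unfolding in_power_gens_Suc by (auto simp del: union_mset_add_mset_left)
  next
    fix m assume "m \<in> {m. set_mset m \<subseteq> V \<and> image_mset \<phi> m \<in> power_gens F (Suc s)}"
    then obtain e n where m: "set_mset m \<subseteq> V" and e: "e \<in> F" and n: "n \<in> power_gens F s"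
      and eq: "image_mset \<phi> m = edge_mon e + n"
      by (auto simp: in_power_gens_Suc)
    obtain a b where ab: "e = {a, b}" "a \<noteq> b" using F[OF e] by (meson card_2_iff)
    have "image_mset \<phi> m = add_mset a (add_mset b n)"
      using eq ab by (simp add: edge_mon_doubleton)
    then obtain x y m' where xy: "m = add_mset x (add_mset y m')" "\<phi> x = a" "\<phi> y = b" "image_mset \<phi> m' = n"
      by (metis msed_map_invR)
    have "x \<noteq> y" using xy ab by auto
    then have "m = edge_mon {x, y} + m'" using xy by (simp add: edge_mon_doubleton)
    moreover have "{x, y} \<in> blowup V \<phi> F"
      using xy m e ab by (auto simp: blowup_def)
    moreover have "m' \<in> power_gens (blowup V \<phi> F) s"
      using xy m n by (auto simp: Suc)
    ultimately show "m \<in> power_gens (blowup V \<phi> F) (Suc s)"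
      by (auto simp: in_power_gens_Suc)
  qed
qed

section \<open>Lifting an exchange property to a blow-up\<close>

lemma map_less_map_iff:
  fixes f g :: "'a \<Rightarrow> 'b::linorder"
  shows "map f xs < map g xs \<longleftrightarrow> (\<exists>ys x zs. xs = ys @ x # zs \<and> (\<forall>y\<in>set ys. f y = g y) \<and> f x < g x)"
proof (induction xs)
  case (Cons a xs)
  show ?case
  proof
    assume "map f (a # xs) < map g (a # xs)"
    then consider "f a < g a" | "f a = g a" "map f xs < map g xs" by auto
    then show "\<exists>ys x zs. a # xs = ys @ x # zs \<and> (\<forall>y\<in>set ys. f y = g y) \<and> f x < g x"
    proof cases
      case 1 then show ?thesis by (metis append_Nil empty_iff list.set(1))
    next
      case 2
      then obtain ys x zs where "xs = ys @ x # zs" "\<forall>y\<in>set ys. f y = g y" "f x < g x"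
        using Cons by blast
      with 2 have "a # xs = (a # ys) @ x # zs \<and> (\<forall>y\<in>set (a # ys). f y = g y) \<and> f x < g x" by simp
      then show ?thesis by blast
    qed
  next
    assume "\<exists>ys x zs. a # xs = ys @ x # zs \<and> (\<forall>y\<in>set ys. f y = g y) \<and> f x < g x"
    then show "map f (a # xs) < map g (a # xs)"
      using Cons by (fastforce simp: Cons_eq_append_conv)
  qed
qed simp

lemma count_image_mset_size: "count (image_mset f m) b = size (filter_mset (\<lambda>x. f x = b) m)"
  by (induction m) auto

text \<open>If the projections differ, a move in \<open>H\<close> is lifted to the fibres. If they
  agree, the move stays inside one fibre and is judged by the negated exponents, which put large
  exponents first.\<close>

lemma blowup_exchange:
  fixes key :: "'b multiset \<Rightarrow> 'k::linorder" and \<phi> :: "'a \<Rightarrow> 'b" and xs :: "'a list" and H :: "'b multiset set"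
  defines "bkey \<equiv> \<lambda>m. (key (image_mset \<phi> m), map (\<lambda>x. - int (count m x)) xs)"
    and "G \<equiv> {m. set_mset m \<subseteq> set xs \<and> image_mset \<phi> m \<in> H}"
  assumes xs: "distinct xs" and inj: "inj_on key H"
    and exchange: "\<And>u v. u \<in> H \<Longrightarrow> v \<in> H \<Longrightarrow> key v < key u \<Longrightarrow>
      \<exists>x y. count u x < count v x \<and> y \<in># u \<and> add_mset x (u - {#y#}) \<in> H \<and>
        key (add_mset x (u - {#y#})) < key u"
    and u: "u \<in> G" and v: "v \<in> G" and less: "bkey v < bkey u"
  shows "\<exists>x y. count u x < count v x \<and> y \<in># u \<and> add_mset x (u - {#y#}) \<in> G \<and>
        bkey (add_mset x (u - {#y#})) < bkey u"
proof -
  have "image_mset \<phi> u \<in> H" "image_mset \<phi> v \<in> H" using u v by (auto simp: G_def)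
  have fibre: "\<exists>x. \<phi> x = b \<and> count m x < count n x"
    if "count (image_mset \<phi> m) b < count (image_mset \<phi> n) b" for m n b
  proof (rule ccontr)
    assume "\<nexists>x. \<phi> x = b \<and> count m x < count n x"
    then have "filter_mset (\<lambda>x. \<phi> x = b) n \<subseteq># filter_mset (\<lambda>x. \<phi> x = b) m"
      by (auto intro!: mset_subset_eqI simp: not_less)
    then show False
      using that size_mset_mono by (fastforce simp: count_image_mset_size)
  qed
  have image: "image_mset \<phi> (add_mset x (u - {#y#})) = add_mset (\<phi> x) (image_mset \<phi> u - {#\<phi> y#})"
    if "y \<in># u" for x y
    using that by (simp add: image_mset_Diff)
  have "key (image_mset \<phi> v) < key (image_mset \<phi> u) \<or> image_mset \<phi> v = image_mset \<phi> u"
    using less inj_onD[OF inj _ \<open>image_mset \<phi> v \<in> H\<close> \<open>image_mset \<phi> u \<in> H\<close>]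
    by (fastforce simp: bkey_def)
  then consider "key (image_mset \<phi> v) < key (image_mset \<phi> u)"
    | "image_mset \<phi> v = image_mset \<phi> u" "map (\<lambda>x. - int (count v x)) xs < map (\<lambda>x. - int (count u x)) xs"
    using less by (auto simp: bkey_def)
  then show ?thesis
  proof cases
    case 1
    then obtain a b where ab: "count (image_mset \<phi> u) a < count (image_mset \<phi> v) a" "b \<in># image_mset \<phi> u"
      "add_mset a (image_mset \<phi> u - {#b#}) \<in> H"
      "key (add_mset a (image_mset \<phi> u - {#b#})) < key (image_mset \<phi> u)"
      using exchange[OF \<open>image_mset \<phi> u \<in> H\<close> \<open>image_mset \<phi> v \<in> H\<close>] by blast
    from fibre[OF ab(1)] obtain x where x: "\<phi> x = a" "count u x < count v x" by blast
    from ab(2) obtain y where y: "y \<in># u" "\<phi> y = b" by auto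
    have "x \<in> set xs" using x(2) v by (auto simp: G_def) (metis count_greater_zero_iff gr_zeroI not_less_zero subsetD)
    then have "add_mset x (u - {#y#}) \<in> G"
      using image[OF y(1), of x] ab(3) x y u by (auto simp: G_def dest: in_diffD)
    moreover have "bkey (add_mset x (u - {#y#})) < bkey u"
      using image[OF y(1), of x] ab(4) x y by (simp add: bkey_def)
    ultimately show ?thesis using x y by blast
  next
    case 2
    from 2(2) obtain ys x zs where split: "xs = ys @ x # zs" "\<forall>y\<in>set ys. count v y = count u y"
      "count u x < count v x"
      by (auto simp: map_less_map_iff)
    \<comment> \<open>Both monomials have the same degree on the fibre of \<open>x\<close>, so the
      surplus of \<open>v\<close> at \<open>x\<close> is balanced by a deficit at some
      \<open>y\<close>.\<close>
    have "\<exists>y. \<phi> y = \<phi> x \<and> count v y < count u y"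
    proof (rule ccontr)
      assume "\<nexists>y. \<phi> y = \<phi> x \<and> count v y < count u y"
      then have "filter_mset (\<lambda>z. \<phi> z = \<phi> x) u \<subseteq># filter_mset (\<lambda>z. \<phi> z = \<phi> x) v"
        by (auto intro!: mset_subset_eqI simp: not_less)
      moreover have "size (filter_mset (\<lambda>z. \<phi> z = \<phi> x) u) = size (filter_mset (\<lambda>z. \<phi> z = \<phi> x) v)"
        using 2(1) by (metis count_image_mset_size)
      ultimately have "filter_mset (\<lambda>z. \<phi> z = \<phi> x) u = filter_mset (\<lambda>z. \<phi> z = \<phi> x) v"
        by (rule mset_subset_eq_same_size)
      then have "count u x = count v x" by (metis (mono_tags, lifting) count_filter_mset)
      then show False using split(3) by simp
    qed
    then obtain y where y: "\<phi> y = \<phi> x" "count v y < count u y" by blast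
    then have "y \<in># u" by (metis count_greater_zero_iff gr_zeroI not_less_zero)
    have "\<phi> x \<in># image_mset \<phi> u" using \<open>y \<in># u\<close> y(1) by (metis image_eqI set_image_mset)
    then have im: "image_mset \<phi> (add_mset x (u - {#y#})) = image_mset \<phi> u"
      using image[OF \<open>y \<in># u\<close>, of x] y(1) by (metis insert_DiffM)
    \<comment> \<open>The exponents of \<open>u\<close> and \<open>v\<close> agree on
      \<open>ys\<close> but differ at \<open>y\<close>; hence \<open>y\<close> is not in
      \<open>ys\<close> and the move leaves these entries unchanged.\<close>
    have "map (\<lambda>z. - int (count (add_mset x (u - {#y#})) z)) xs < map (\<lambda>z. - int (count u z)) xs"
      unfolding map_less_map_iff
    proof (intro exI conjI ballI)
      show "xs = ys @ x # zs" by fact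
      show "- int (count (add_mset x (u - {#y#})) z) = - int (count u z)" if "z \<in> set ys" for z
        using that split xs y by auto
      show "- int (count (add_mset x (u - {#y#})) x) < - int (count u x)"
        using split(3) y by auto
    qed
    then have "bkey (add_mset x (u - {#y#})) < bkey u"
      unfolding bkey_def im by simp
    moreover have "add_mset x (u - {#y#}) \<in> G"
      using u im split(1) by (auto simp: G_def dest: in_diffD)
    ultimately show ?thesis using split(3) \<open>y \<in># u\<close> by blast
  qed
qed

section \<open>Graph properties of blow-ups\<close>

lemma adj_blowup: "adj (blowup V \<phi> F) x y \<longleftrightarrow> x \<in> V \<and> y \<in> V \<and> {\<phi> x, \<phi> y} \<in> F"
  by (auto simp: adj_def blowup_def doubleton_eq_iff insert_commute)

lemma simple_graph_blowup:
  assumes "finite V" and F: "\<And>e. e \<in> F \<Longrightarrow> card e = 2"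
  shows "simple_graph V (blowup V \<phi> F)"
proof -
  have "card {x, y} = 2" if "{\<phi> x, \<phi> y} \<in> F" for x y
    using F[OF that] by (cases "x = y") auto
  then show ?thesis using assms(1) by (auto simp: simple_graph_def blowup_def)
qed

text \<open>Disjoint edges may have meeting projections. Then an endpoint of one has the same image
  as an endpoint of the other and is adjacent to the partner of the latter.\<close>

lemma gapfree_blowup:
  assumes F: "\<And>e. e \<in> F \<Longrightarrow> card e = 2" and gap: "gapfree F"
  shows "gapfree (blowup V \<phi> F)"
proof -
  have link: "\<exists>p\<in>{x, y}. \<exists>q\<in>{z, w}. {\<phi> p, \<phi> q} \<in> F"
    if xy: "{\<phi> x, \<phi> y} \<in> F" and zw: "{\<phi> z, \<phi> w} \<in> F" for x y z w
  proof (cases "{\<phi> x, \<phi> y} \<inter> {\<phi> z, \<phi> w} = {}")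
    case True
    then obtain f where f: "f \<in> F" "f \<inter> {\<phi> x, \<phi> y} \<noteq> {}" "f \<inter> {\<phi> z, \<phi> w} \<noteq> {}"
      using gap[unfolded gapfree_def, rule_format, OF xy zw] by metis
    from f(2) obtain p where p: "p \<in> {x, y}" "\<phi> p \<in> f" by auto
    from f(3) obtain q where q: "q \<in> {z, w}" "\<phi> q \<in> f" by auto
    have "\<phi> p \<noteq> \<phi> q" using True p(1) q(1) by auto
    then have "f = {\<phi> p, \<phi> q}" using F[OF f(1)] p(2) q(2) by (auto simp: card_2_iff)
    then show ?thesis using f(1) p(1) q(1) by metis
  next
    case False
    then consider "\<phi> x = \<phi> z" | "\<phi> x = \<phi> w" | "\<phi> y = \<phi> z" | "\<phi> y = \<phi> w" by auto
    then show ?thesis using zw by cases (simp_all add: insert_commute)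
  qed
  show ?thesis
    unfolding gapfree_def
  proof (intro ballI impI)
    fix e e' assume "e \<in> blowup V \<phi> F" "e' \<in> blowup V \<phi> F"
    then obtain x y z w where e: "e = {x, y}" "x \<in> V" "y \<in> V" "{\<phi> x, \<phi> y} \<in> F"
      and e': "e' = {z, w}" "z \<in> V" "w \<in> V" "{\<phi> z, \<phi> w} \<in> F"
      unfolding blowup_def by blast
    from link[OF e(4) e'(4)] obtain p q where pq: "p \<in> {x, y}" "q \<in> {z, w}" "{\<phi> p, \<phi> q} \<in> F" by blast
    then have "p \<in> V" "q \<in> V" using e e' by auto
    then have "{p, q} \<in> blowup V \<phi> F" using pq(3) unfolding blowup_def by blast
    then show "\<exists>f\<in>blowup V \<phi> F. f \<inter> e \<noteq> {} \<and> f \<inter> e' \<noteq> {}"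
      using pq(1,2) e(1) e'(1) by (intro bexI[of _ "{p, q}"]) auto
  qed
qed

text \<open>Ties are broken along any listing \<open>xs\<close> of \<open>V\<close>. The exponents
  along \<open>xs\<close> determine a monomial on \<open>V\<close>, which makes the combined key
  injective.\<close>

lemma linear_quotients_power_blowup:
  fixes key :: "'b multiset \<Rightarrow> 'k::linorder"
  assumes F: "\<And>e. e \<in> F \<Longrightarrow> card e = 2" and V: "finite V"
    and inj: "inj_on key (power_gens F s)"
    and exchange: "\<And>u v. u \<in> power_gens F s \<Longrightarrow> v \<in> power_gens F s \<Longrightarrow> key v < key u \<Longrightarrow>
      \<exists>x y. count u x < count v x \<and> y \<in># u \<and> add_mset x (u - {#y#}) \<in> power_gens F s \<and>
        key (add_mset x (u - {#y#})) < key u"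
  shows "linear_quotients V (power_gens (blowup V \<phi> F) s)"
proof -
  obtain xs where xs: "set xs = V" "distinct xs" using finite_distinct_list[OF V] by blast
  let ?key = "\<lambda>m. (key (image_mset \<phi> m), map (\<lambda>x. - int (count m x)) xs)"
  let ?G = "{m. set_mset m \<subseteq> set xs \<and> image_mset \<phi> m \<in> power_gens F s}"
  have G: "power_gens (blowup V \<phi> F) s = ?G"
    using power_gens_blowup[OF F] xs(1) by simp
  have fin: "finite (blowup V \<phi> F)" and card: "\<And>e. e \<in> blowup V \<phi> F \<Longrightarrow> card e = 2"
    using simple_graph_blowup[OF V F, of F \<phi>] finite_subset[of "blowup V \<phi> F" "Pow V"] V
    by (auto simp: simple_graph_def)
  have key_inj: "inj_on ?key ?G"
  proof (rule inj_onI)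
    fix m n assume mn: "m \<in> ?G" "n \<in> ?G" "?key m = ?key n"
    have "count m x = count n x" for x
    proof (cases "x \<in> set xs")
      case False
      then have "x \<notin># m" "x \<notin># n" using mn(1,2) by auto
      then show ?thesis by (simp add: not_in_iff)
    qed (use mn(3) in simp)
    then show "m = n" by (rule multiset_eqI)
  qed
  have "linear_quotients V ?G"
  proof (rule linear_quotients_by_key[where key = ?key and d = "2 * s"])
    show "finite ?G"
      unfolding G[symmetric] by (rule finite_power_gens[OF fin])
    show "size u = 2 * s" if "u \<in> ?G" for u
      using that card unfolding G[symmetric] by (rule size_power_gens[rotated])
    show "set_mset u \<subseteq> V" if "u \<in> ?G" for u
      using that xs(1) by simp
    show "inj_on ?key ?G" by (rule key_inj)
    show "\<exists>x y. count u x < count v x \<and> y \<in># u \<and> add_mset x (u - {#y#}) \<in> ?G \<and>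
        ?key (add_mset x (u - {#y#})) < ?key u"
      if "u \<in> ?G" "v \<in> ?G" "?key v < ?key u" for u v
      by (rule blowup_exchange[OF xs(2) inj exchange that])
  qed
  then show ?thesis by (simp only: G)
qed

section \<open>Exponent vectors of the wheel\<close>

text \<open>
  By Tutte's theorem, in a gap-free graph a vector \<open>a\<close> with even total is a sum of edge vectors iff
  \<open>a(S) \<le> a(N(S))\<close> for every independent set \<open>S\<close>. For the wheel with rim \<open>0, \<dots>, 4\<close> and hub \<open>5\<close> these are
  the conditions below; for a maximal independent \<open>S\<close> the condition reads \<open>a(S) \<le> s\<close>, where \<open>2 s\<close> is the total.
\<close>

definition wheel_degrees :: "int \<Rightarrow> int \<Rightarrow> int \<Rightarrow> int \<Rightarrow> int \<Rightarrow> int \<Rightarrow> int \<Rightarrow> bool" where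
  "wheel_degrees s a0 a1 a2 a3 a4 c \<longleftrightarrow>
     a0 + a1 + a2 + a3 + a4 + c = 2 * s \<and>
     0 \<le> a0 \<and> 0 \<le> a1 \<and> 0 \<le> a2 \<and> 0 \<le> a3 \<and> 0 \<le> a4 \<and> 0 \<le> c \<and> c \<le> s \<and>
     a0 + a2 \<le> s \<and> a1 + a3 \<le> s \<and> a2 + a4 \<le> s \<and> a3 + a0 \<le> s \<and> a4 + a1 \<le> s \<and>
     a0 \<le> a4 + a1 + c \<and> a1 \<le> a0 + a2 + c \<and> a2 \<le> a1 + a3 + c \<and>
     a3 \<le> a2 + a4 + c \<and> a4 \<le> a3 + a0 + c"

text \<open>This is the induction step for the sufficiency of the conditions; the disjuncts run
  through the ten edges of the wheel.\<close>

lemma wheel_degrees_remove_edge: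
  assumes "wheel_degrees (s + 1) a0 a1 a2 a3 a4 c" "0 \<le> s"
  shows "wheel_degrees s (a0 - 1) (a1 - 1) a2 a3 a4 c \<or> wheel_degrees s a0 (a1 - 1) (a2 - 1) a3 a4 c \<or>
    wheel_degrees s a0 a1 (a2 - 1) (a3 - 1) a4 c \<or> wheel_degrees s a0 a1 a2 (a3 - 1) (a4 - 1) c \<or>
    wheel_degrees s (a0 - 1) a1 a2 a3 (a4 - 1) c \<or>
    wheel_degrees s (a0 - 1) a1 a2 a3 a4 (c - 1) \<or> wheel_degrees s a0 (a1 - 1) a2 a3 a4 (c - 1) \<or>
    wheel_degrees s a0 a1 (a2 - 1) a3 a4 (c - 1) \<or> wheel_degrees s a0 a1 a2 (a3 - 1) a4 (c - 1) \<or>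
    wheel_degrees s a0 a1 a2 a3 (a4 - 1) (c - 1)"
  using assms unfolding wheel_degrees_def by (smt (z3))

text \<open>
  In the reverse lexicographic order that compares the variables in the order \<open>5, 4, 3, 0, 1\<close> (large exponents
  first for the hub, small ones first for the rim) the only monomials violating the exchange property are
  \<open>u = (x\<^sub>0x\<^sub>4)\<^sup>p(x\<^sub>2x\<^sub>3)\<^sup>q\<close> with \<open>p > 0\<close>. They are moved directly behind \<open>u x\<^sub>3/x\<^sub>0\<close>.
\<close>

definition delayed :: "int \<Rightarrow> int \<Rightarrow> int \<Rightarrow> int \<Rightarrow> int \<Rightarrow> int \<Rightarrow> bool" where
  "delayed a0 a1 a2 a3 a4 c \<longleftrightarrow> c = 0 \<and> a1 = 0 \<and> a0 = a4 \<and> a2 = a3 \<and> 0 < a0"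

text \<open>The exponent \<open>a2\<close> is left out because the total is fixed. A delayed
  monomial takes the first five entries of the monomial it must follow; the last entry separates the
  two.\<close>

definition wheel_key :: "int \<Rightarrow> int \<Rightarrow> int \<Rightarrow> int \<Rightarrow> int \<Rightarrow> int \<Rightarrow> int list" where
  "wheel_key a0 a1 a2 a3 a4 c =
     (if delayed a0 a1 a2 a3 a4 c then [- c, a4, a3 + 1, a0 - 1, a1, 1]
      else [- c, a4, a3, a0, a1, 0])"

lemma wheel_key_inject:
  assumes "wheel_key a0 a1 a2 a3 a4 c = wheel_key b0 b1 b2 b3 b4 d"
    and "wheel_degrees s a0 a1 a2 a3 a4 c" "wheel_degrees s b0 b1 b2 b3 b4 d"
  shows "a0 = b0 \<and> a1 = b1 \<and> a2 = b2 \<and> a3 = b3 \<and> a4 = b4 \<and> c = d"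
proof -
  have "a0 = b0 \<and> a1 = b1 \<and> a3 = b3 \<and> a4 = b4 \<and> c = d"
    using assms(1) by (simp add: wheel_key_def split: if_splits)
  moreover have "a0 + a1 + a2 + a3 + a4 + c = b0 + b1 + b2 + b3 + b4 + d"
    using assms(2,3) by (simp add: wheel_degrees_def)
  ultimately show ?thesis by simp
qed

text \<open>Delaying keeps the first two entries and increases the key. So a smaller
  \<open>a4\<close> wins in any case, and in the next three lemmas only the smaller side has to be
  undelayed.\<close>

lemma wheel_key_less_4:
  "a4 < b4 \<Longrightarrow> wheel_key a0 a1 a2 a3 a4 c < wheel_key b0 b1 b2 b3 b4 c"
  by (simp add: wheel_key_def)

lemma wheel_key_less_3:
  assumes "\<not> delayed a0 a1 a2 a3 a4 c" "a3 < b3"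
  shows "wheel_key a0 a1 a2 a3 a4 c < wheel_key b0 b1 b2 b3 a4 c"
  using assms by (simp add: wheel_key_def)

lemma wheel_key_less_0:
  assumes "\<not> delayed a0 a1 a2 a3 a4 c" "a0 < b0"
  shows "wheel_key a0 a1 a2 a3 a4 c < wheel_key b0 b1 b2 a3 a4 c"
  using assms by (simp add: wheel_key_def)

lemma wheel_key_less_1:
  assumes "\<not> delayed a0 a1 a2 a3 a4 c" "a1 < b1"
  shows "wheel_key a0 a1 a2 a3 a4 c < wheel_key a0 b1 b2 a3 a4 c"
  using assms by (simp add: wheel_key_def)

section \<open>Exchange moves on the exponent vectors of the wheel\<close>

context
  fixes s u0 u1 u2 u3 u4 u5 v0 v1 v2 v3 v4 v5 :: int
  assumes u: "wheel_degrees s u0 u1 u2 u3 u4 u5" and v: "wheel_degrees s v0 v1 v2 v3 v4 v5"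
begin

private abbreviation "better a0 a1 a2 a3 a4 c \<equiv>
  wheel_degrees s a0 a1 a2 a3 a4 c \<and> wheel_key a0 a1 a2 a3 a4 c < wheel_key u0 u1 u2 u3 u4 u5"

text \<open>Trading a rim variable for the hub keeps all upper bounds, since
  \<open>u5 < v5 \<le> s\<close>. Only nonnegativity is at stake: the rim total
  \<open>2 * s - u5\<close> exceeds \<open>s\<close> while \<open>u4 + u1 \<le> s\<close>, so
  \<open>u0\<close>, \<open>u2\<close> or \<open>u3\<close> is positive.\<close>

lemma exchange_hub:
  assumes "u5 < v5"
  shows "u5 < v5 \<and> better (u0 - 1) u1 u2 u3 u4 (u5 + 1) \<or>
    u5 < v5 \<and> better u0 u1 (u2 - 1) u3 u4 (u5 + 1) \<or>
    u5 < v5 \<and> better u0 u1 u2 (u3 - 1) u4 (u5 + 1)"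
proof -
  have "wheel_degrees s (u0 - 1) u1 u2 u3 u4 (u5 + 1) \<or>
      wheel_degrees s u0 u1 (u2 - 1) u3 u4 (u5 + 1) \<or>
      wheel_degrees s u0 u1 u2 (u3 - 1) u4 (u5 + 1)"
    using u v assms unfolding wheel_degrees_def by (smt (z3))
  then show ?thesis
    using assms by (auto simp: wheel_key_def)
qed

text \<open>Both \<open>u x1/x4\<close> and \<open>u x3/x0\<close> are generators preceding
  \<open>u\<close>, the latter by the choice of the key; it remains to see that \<open>v\<close> is
  larger at \<open>x1\<close> or \<open>x3\<close>.\<close>

lemma exchange_delayed:
  assumes "2 \<le> s" "v5 = u5" "wheel_key v0 v1 v2 v3 v4 v5 < wheel_key u0 u1 u2 u3 u4 u5"
    and "delayed u0 u1 u2 u3 u4 u5"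
  shows "u1 < v1 \<and> better u0 (u1 + 1) u2 u3 (u4 - 1) u5 \<or>
    u3 < v3 \<and> better (u0 - 1) u1 u2 (u3 + 1) u4 u5"
proof -
  have "v4 < u4 \<or> v4 = u4 \<and> (v3 \<noteq> u3 \<or> v0 \<noteq> u0 \<or> v1 \<noteq> u1 \<or> v2 \<noteq> u2)"
    using assms by (auto simp: wheel_key_def split: if_splits)
  \<comment> \<open>Suppose \<open>v1 = 0\<close> and \<open>v3 \<le> u3\<close>. As
    \<open>v4 \<le> u4\<close> and \<open>u3 + u4 = s\<close>, the bound
    \<open>v0 + v2 \<le> s\<close> forces \<open>v3 = u3\<close> and \<open>v4 = u4\<close>; then
    \<open>v0 \<le> v4\<close> and \<open>v2 \<le> v3\<close> make \<open>v\<close> equal to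
    \<open>u\<close>.\<close>
  then have "u1 < v1 \<or> u3 < v3"
    using u v assms(2,4) unfolding delayed_def wheel_degrees_def by (smt (z3))
  moreover have "better u0 (u1 + 1) u2 u3 (u4 - 1) u5" "better (u0 - 1) u1 u2 (u3 + 1) u4 u5"
    using u assms(1,4) by (auto simp: wheel_degrees_def wheel_key_def delayed_def)
  ultimately show ?thesis by blast
qed

lemma exchange_same_4:
  assumes "2 \<le> s" "v5 = u5" "wheel_key v0 v1 v2 v3 v4 v5 < wheel_key u0 u1 u2 u3 u4 u5"
    and nd: "\<not> delayed u0 u1 u2 u3 u4 u5" and same: "v4 = u4"
  shows "u0 < v0 \<and> better (u0 + 1) u1 u2 (u3 - 1) u4 u5 \<or>
    u1 < v1 \<and> better u0 (u1 + 1) u2 (u3 - 1) u4 u5 \<or>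
    u2 < v2 \<and> better u0 u1 (u2 + 1) (u3 - 1) u4 u5 \<or>
    u1 < v1 \<and> better (u0 - 1) (u1 + 1) u2 u3 u4 u5 \<or>
    u2 < v2 \<and> better (u0 - 1) u1 (u2 + 1) u3 u4 u5 \<or>
    u2 < v2 \<and> better u0 (u1 - 1) (u2 + 1) u3 u4 u5"
proof -
  \<comment> \<open>The raised exponent of \<open>x1\<close> is positive, which rules out
    \<open>delayed\<close>.\<close>
  have "\<not> delayed u0 (u1 + 1) u2 (u3 - 1) u4 u5" "\<not> delayed (u0 - 1) (u1 + 1) u2 u3 u4 u5"
    using u by (simp_all add: wheel_degrees_def delayed_def)
  then have keys: "\<not> delayed (u0 + 1) u1 u2 (u3 - 1) u4 u5 \<Longrightarrow>
      wheel_key (u0 + 1) u1 u2 (u3 - 1) u4 u5 < wheel_key u0 u1 u2 u3 u4 u5"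
    "wheel_key u0 (u1 + 1) u2 (u3 - 1) u4 u5 < wheel_key u0 u1 u2 u3 u4 u5"
    "\<not> delayed u0 u1 (u2 + 1) (u3 - 1) u4 u5 \<Longrightarrow>
      wheel_key u0 u1 (u2 + 1) (u3 - 1) u4 u5 < wheel_key u0 u1 u2 u3 u4 u5"
    "wheel_key (u0 - 1) (u1 + 1) u2 u3 u4 u5 < wheel_key u0 u1 u2 u3 u4 u5"
    "\<not> delayed (u0 - 1) u1 (u2 + 1) u3 u4 u5 \<Longrightarrow>
      wheel_key (u0 - 1) u1 (u2 + 1) u3 u4 u5 < wheel_key u0 u1 u2 u3 u4 u5"
    by (simp_all add: wheel_key_less_3 wheel_key_less_0)
  \<comment> \<open>The first two entries agree. As \<open>u\<close> is not delayed, its last entry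
    is 0 and never decides; a delayed \<open>v\<close> enters with shifted exponents.\<close>
  have "if delayed v0 v1 v2 v3 v4 v5
      then v3 + 1 < u3 \<or> v3 + 1 = u3 \<and> (v0 - 1 < u0 \<or> v0 - 1 = u0 \<and> v1 < u1)
      else v3 < u3 \<or> v3 = u3 \<and> (v0 < u0 \<or> v0 = u0 \<and> v1 < u1)"
    using assms(2-5) by (simp add: wheel_key_def split: if_splits)
  then consider
    "delayed v0 v1 v2 v3 v4 v5"
      "v3 + 1 < u3 \<or> v3 + 1 = u3 \<and> (v0 - 1 < u0 \<or> v0 - 1 = u0 \<and> v1 < u1)"
  | "\<not> delayed v0 v1 v2 v3 v4 v5" "v3 < u3"
  | "\<not> delayed v0 v1 v2 v3 v4 v5" "v3 = u3" "v0 < u0"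
  | "\<not> delayed v0 v1 v2 v3 v4 v5" "v3 = u3" "v0 = u0" "v1 < u1"
    by (auto split: if_splits)
  then show ?thesis
  proof cases
    case 1
    \<comment> \<open>Since \<open>v\<close> is delayed, \<open>s = v0 + v3\<close>; with
      \<open>v3 < u3\<close> and \<open>u0 + u3 \<le> s\<close> this gives
      \<open>u0 < v0\<close>.\<close>
    then have "u0 < v0 \<and> wheel_degrees s (u0 + 1) u1 u2 (u3 - 1) u4 u5 \<and>
        \<not> delayed (u0 + 1) u1 u2 (u3 - 1) u4 u5"
      using u v assms(1,2) same nd unfolding wheel_degrees_def delayed_def by (smt (z3))
    then show ?thesis using keys by simp
  next
    case 2
    then have "u0 < v0 \<and> wheel_degrees s (u0 + 1) u1 u2 (u3 - 1) u4 u5 \<and>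
        \<not> delayed (u0 + 1) u1 u2 (u3 - 1) u4 u5 \<or>
      u1 < v1 \<and> wheel_degrees s u0 (u1 + 1) u2 (u3 - 1) u4 u5 \<or>
      u2 < v2 \<and> wheel_degrees s u0 u1 (u2 + 1) (u3 - 1) u4 u5 \<and>
        \<not> delayed u0 u1 (u2 + 1) (u3 - 1) u4 u5"
      using u v assms(1,2) same nd unfolding wheel_degrees_def delayed_def by (smt (z3))
    then show ?thesis using keys by (elim disjE) simp_all
  next
    case 3
    then have "u1 < v1 \<and> wheel_degrees s (u0 - 1) (u1 + 1) u2 u3 u4 u5 \<or>
      u2 < v2 \<and> wheel_degrees s (u0 - 1) u1 (u2 + 1) u3 u4 u5 \<and>
        \<not> delayed (u0 - 1) u1 (u2 + 1) u3 u4 u5"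
      using u v assms(1,2) same nd unfolding wheel_degrees_def delayed_def by (smt (z3))
    then show ?thesis using keys by (elim disjE) simp_all
  next
    case 4
    \<comment> \<open>Only \<open>x1\<close> and \<open>x2\<close> can differ, so equal totals give
      \<open>u2 < v2\<close>.\<close>
    then have "u2 < v2 \<and> wheel_degrees s u0 (u1 - 1) (u2 + 1) u3 u4 u5 \<and>
        \<not> delayed u0 (u1 - 1) (u2 + 1) u3 u4 u5"
      using u v assms(1,2) same nd unfolding wheel_degrees_def delayed_def by (smt (z3))
    then show ?thesis using wheel_key_less_1 nd by simp
  qed
qed

text \<open>By equal totals some other rim exponent is larger in \<open>v\<close>, and trading
  \<open>x4\<close> for it lowers the key at once. Where the degree conditions block this, one of
  the last three moves, which lower \<open>x3\<close> or \<open>x0\<close>, takes its place.\<close>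

lemma exchange_less_4:
  assumes "2 \<le> s" "v5 = u5" "v4 < u4" and nd: "\<not> delayed u0 u1 u2 u3 u4 u5"
  shows "u0 < v0 \<and> better (u0 + 1) u1 u2 u3 (u4 - 1) u5 \<or>
    u1 < v1 \<and> better u0 (u1 + 1) u2 u3 (u4 - 1) u5 \<or>
    u2 < v2 \<and> better u0 u1 (u2 + 1) u3 (u4 - 1) u5 \<or>
    u3 < v3 \<and> better u0 u1 u2 (u3 + 1) (u4 - 1) u5 \<or>
    u0 < v0 \<and> better (u0 + 1) u1 u2 (u3 - 1) u4 u5 \<or>
    u1 < v1 \<and> better u0 (u1 + 1) u2 (u3 - 1) u4 u5 \<or>
    u2 < v2 \<and> better (u0 - 1) u1 (u2 + 1) u3 u4 u5"
proof -
  have "\<not> delayed u0 (u1 + 1) u2 (u3 - 1) u4 u5"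
    using u by (simp add: wheel_degrees_def delayed_def)
  then have keys: "wheel_key (u0 + 1) u1 u2 u3 (u4 - 1) u5 < wheel_key u0 u1 u2 u3 u4 u5"
    "wheel_key u0 (u1 + 1) u2 u3 (u4 - 1) u5 < wheel_key u0 u1 u2 u3 u4 u5"
    "wheel_key u0 u1 (u2 + 1) u3 (u4 - 1) u5 < wheel_key u0 u1 u2 u3 u4 u5"
    "wheel_key u0 u1 u2 (u3 + 1) (u4 - 1) u5 < wheel_key u0 u1 u2 u3 u4 u5"
    "\<not> delayed (u0 + 1) u1 u2 (u3 - 1) u4 u5 \<Longrightarrow>
      wheel_key (u0 + 1) u1 u2 (u3 - 1) u4 u5 < wheel_key u0 u1 u2 u3 u4 u5"
    "wheel_key u0 (u1 + 1) u2 (u3 - 1) u4 u5 < wheel_key u0 u1 u2 u3 u4 u5"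
    "\<not> delayed (u0 - 1) u1 (u2 + 1) u3 u4 u5 \<Longrightarrow>
      wheel_key (u0 - 1) u1 (u2 + 1) u3 u4 u5 < wheel_key u0 u1 u2 u3 u4 u5"
    by (simp_all add: wheel_key_less_4 wheel_key_less_3 wheel_key_less_0)
  \<comment> \<open>Each case gets by with six of the seven moves: without trading \<open>x4\<close>
    for \<open>x0\<close> when \<open>u5 = 0\<close>, and without trading \<open>x3\<close> for
    \<open>x1\<close> otherwise.\<close>
  consider "u5 = 0" | "u5 \<noteq> 0" by blast
  then have "u0 < v0 \<and> wheel_degrees s (u0 + 1) u1 u2 u3 (u4 - 1) u5 \<or>
      u1 < v1 \<and> wheel_degrees s u0 (u1 + 1) u2 u3 (u4 - 1) u5 \<or>
      u2 < v2 \<and> wheel_degrees s u0 u1 (u2 + 1) u3 (u4 - 1) u5 \<or>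
      u3 < v3 \<and> wheel_degrees s u0 u1 u2 (u3 + 1) (u4 - 1) u5 \<or>
      u0 < v0 \<and> wheel_degrees s (u0 + 1) u1 u2 (u3 - 1) u4 u5 \<and>
        \<not> delayed (u0 + 1) u1 u2 (u3 - 1) u4 u5 \<or>
      u1 < v1 \<and> wheel_degrees s u0 (u1 + 1) u2 (u3 - 1) u4 u5 \<or>
      u2 < v2 \<and> wheel_degrees s (u0 - 1) u1 (u2 + 1) u3 u4 u5 \<and>
        \<not> delayed (u0 - 1) u1 (u2 + 1) u3 u4 u5"
  proof cases
    case 1
    have "u1 < v1 \<and> wheel_degrees s u0 (u1 + 1) u2 u3 (u4 - 1) u5 \<or>
      u2 < v2 \<and> wheel_degrees s u0 u1 (u2 + 1) u3 (u4 - 1) u5 \<or>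
      u3 < v3 \<and> wheel_degrees s u0 u1 u2 (u3 + 1) (u4 - 1) u5 \<or>
      u0 < v0 \<and> wheel_degrees s (u0 + 1) u1 u2 (u3 - 1) u4 u5 \<and>
        \<not> delayed (u0 + 1) u1 u2 (u3 - 1) u4 u5 \<or>
      u1 < v1 \<and> wheel_degrees s u0 (u1 + 1) u2 (u3 - 1) u4 u5 \<or>
      u2 < v2 \<and> wheel_degrees s (u0 - 1) u1 (u2 + 1) u3 u4 u5 \<and>
        \<not> delayed (u0 - 1) u1 (u2 + 1) u3 u4 u5"
      using 1 u v assms unfolding wheel_degrees_def delayed_def by (smt (z3))
    then show ?thesis by simp
  next
    case 2
    have "u0 < v0 \<and> wheel_degrees s (u0 + 1) u1 u2 u3 (u4 - 1) u5 \<or>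
      u1 < v1 \<and> wheel_degrees s u0 (u1 + 1) u2 u3 (u4 - 1) u5 \<or>
      u2 < v2 \<and> wheel_degrees s u0 u1 (u2 + 1) u3 (u4 - 1) u5 \<or>
      u3 < v3 \<and> wheel_degrees s u0 u1 u2 (u3 + 1) (u4 - 1) u5 \<or>
      u0 < v0 \<and> wheel_degrees s (u0 + 1) u1 u2 (u3 - 1) u4 u5 \<and>
        \<not> delayed (u0 + 1) u1 u2 (u3 - 1) u4 u5 \<or>
      u2 < v2 \<and> wheel_degrees s (u0 - 1) u1 (u2 + 1) u3 u4 u5 \<and>
        \<not> delayed (u0 - 1) u1 (u2 + 1) u3 u4 u5"
      using 2 u v assms unfolding wheel_degrees_def delayed_def by (smt (z3))
    then show ?thesis by (elim disjE) simp_all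
  qed
  then show ?thesis using keys by (elim disjE) simp_all
qed

lemma wheel_degrees_exchange:
  assumes "2 \<le> s" "wheel_key v0 v1 v2 v3 v4 v5 < wheel_key u0 u1 u2 u3 u4 u5"
  shows "u0 < v0 \<and> better (u0 + 1) u1 u2 (u3 - 1) u4 u5 \<or>
    u0 < v0 \<and> better (u0 + 1) u1 u2 u3 (u4 - 1) u5 \<or>
    u1 < v1 \<and> better (u0 - 1) (u1 + 1) u2 u3 u4 u5 \<or>
    u1 < v1 \<and> better u0 (u1 + 1) u2 (u3 - 1) u4 u5 \<or>
    u1 < v1 \<and> better u0 (u1 + 1) u2 u3 (u4 - 1) u5 \<or>
    u2 < v2 \<and> better (u0 - 1) u1 (u2 + 1) u3 u4 u5 \<or>
    u2 < v2 \<and> better u0 (u1 - 1) (u2 + 1) u3 u4 u5 \<or>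
    u2 < v2 \<and> better u0 u1 (u2 + 1) (u3 - 1) u4 u5 \<or>
    u2 < v2 \<and> better u0 u1 (u2 + 1) u3 (u4 - 1) u5 \<or>
    u3 < v3 \<and> better (u0 - 1) u1 u2 (u3 + 1) u4 u5 \<or>
    u3 < v3 \<and> better u0 u1 u2 (u3 + 1) (u4 - 1) u5 \<or>
    u5 < v5 \<and> better (u0 - 1) u1 u2 u3 u4 (u5 + 1) \<or>
    u5 < v5 \<and> better u0 u1 (u2 - 1) u3 u4 (u5 + 1) \<or>
    u5 < v5 \<and> better u0 u1 u2 (u3 - 1) u4 (u5 + 1)"
proof -
  have "u5 < v5 \<or> v5 = u5 \<and> v4 \<le> u4"
    using assms(2) by (auto simp: wheel_key_def split: if_splits)
  then consider "u5 < v5" | "v5 = u5" "delayed u0 u1 u2 u3 u4 u5"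
    | "v5 = u5" "\<not> delayed u0 u1 u2 u3 u4 u5" "v4 = u4"
    | "v5 = u5" "\<not> delayed u0 u1 u2 u3 u4 u5" "v4 < u4"
    by linarith
  then show ?thesis
  proof cases
    case 1 from exchange_hub[OF this] show ?thesis by (elim disjE) simp_all
  next
    case 2 from exchange_delayed[OF assms(1) 2(1) assms(2) 2(2)] show ?thesis by (elim disjE) simp_all
  next
    case 3 from exchange_same_4[OF assms(1) 3(1) assms(2) 3(2,3)] show ?thesis by (elim disjE) simp_all
  next
    case 4 from exchange_less_4[OF assms(1) 4(1,3,2)] show ?thesis by (elim disjE) simp_all
  qed
qed

end

section \<open>Powers of the edge ideal of the wheel\<close>

definition wheel_edges :: "nat set set" where
  "wheel_edges = {{0,1},{1,2},{2,3},{3,4},{0,4},{0,5},{1,5},{2,5},{3,5},{4,5}}"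

text \<open>Exponents are cast to integers, where subtraction is not truncated. The result type is
  free, to accommodate both \<open>wheel_degrees\<close> and \<open>wheel_key\<close>.\<close>

definition at_counts :: "(int \<Rightarrow> int \<Rightarrow> int \<Rightarrow> int \<Rightarrow> int \<Rightarrow> int \<Rightarrow> 'a) \<Rightarrow> nat multiset \<Rightarrow> 'a" where
  "at_counts f m = f (int (count m 0)) (int (count m 1)) (int (count m 2))
     (int (count m 3)) (int (count m 4)) (int (count m 5))"

lemma card_wheel_edges: "e \<in> wheel_edges \<Longrightarrow> card e = 2"
  unfolding wheel_edges_def insert_iff empty_iff by (elim disjE FalseE) simp_all

lemma all_less_6: "(\<forall>i<6. P i) \<longleftrightarrow> P 0 \<and> P 1 \<and> P 2 \<and> P 3 \<and> P 4 \<and> P (5::nat)"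
  by (auto simp: eval_nat_numeral All_less_Suc)

text \<open>Multiplying by an edge preserves all conditions; conversely
  \<open>wheel_degrees_remove_edge\<close> splits off an edge.\<close>

lemma power_gens_wheel:
  "power_gens wheel_edges s = {m. set_mset m \<subseteq> {..<6} \<and> at_counts (wheel_degrees (int s)) m}"
proof (induction s)
  case 0
  have "m = {#}" if "set_mset m \<subseteq> {..<6}" "at_counts (wheel_degrees 0) m" for m
  proof -
    have "\<forall>i<6. count m i = 0"
      using that(2) unfolding all_less_6 by (simp add: at_counts_def wheel_degrees_def)
    then show ?thesis using that(1) by (metis count_eq_zero_iff lessThan_iff multiset_nonemptyE subsetD)
  qed
  then show ?case by (auto simp: power_gens_0 at_counts_def wheel_degrees_def)
next
  case (Suc s)
  show ?case
  proof (intro equalityI subsetI)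
    fix m assume "m \<in> power_gens wheel_edges (Suc s)"
    then obtain e m' where e: "e \<in> wheel_edges" and m': "set_mset m' \<subseteq> {..<6}"
      "at_counts (wheel_degrees (int s)) m'" and m: "m = edge_mon e + m'"
      unfolding in_power_gens_Suc Suc by blast
    have "at_counts (wheel_degrees (int (Suc s))) m"
      using e m'(2) unfolding wheel_edges_def insert_iff empty_iff m
      by (elim disjE FalseE) (simp_all add: edge_mon_doubleton at_counts_def wheel_degrees_def)
    moreover have "set_mset m \<subseteq> {..<6}"
      using m m' e by (auto simp: wheel_edges_def edge_mon_doubleton)
    ultimately show "m \<in> {m. set_mset m \<subseteq> {..<6} \<and> at_counts (wheel_degrees (int (Suc s))) m}" by blast
  next
    fix m assume "m \<in> {m. set_mset m \<subseteq> {..<6} \<and> at_counts (wheel_degrees (int (Suc s))) m}"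
    then have m: "set_mset m \<subseteq> {..<6}" and deg_m: "at_counts (wheel_degrees (int s + 1)) m"
      by (auto simp: add.commute)
    let ?f = "\<lambda>x y i. int (count m i) - of_bool (i = x) - of_bool (i = y)"
    have remove: "m \<in> power_gens wheel_edges (Suc s)"
      if xy: "{x, y} \<in> wheel_edges" "x \<noteq> y" "x < 6" "y < 6"
        and deg: "wheel_degrees (int s) (?f x y 0) (?f x y 1) (?f x y 2) (?f x y 3) (?f x y 4) (?f x y 5)"
      for x y
    proof -
      \<comment> \<open>Nonnegativity of the reduced vector shows that \<open>x\<close> and
        \<open>y\<close> divide \<open>m\<close>, so the multiset difference has exactly these
        exponents.\<close>
      have "\<forall>i<6. 0 \<le> ?f x y i"
        using deg unfolding all_less_6 wheel_degrees_def by blast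
      then have "0 \<le> ?f x y x" "0 \<le> ?f x y y" using xy by blast+
      then have mem: "x \<in># m" "y \<in># m" using xy(2) by (auto simp flip: count_greater_zero_iff)
      then have "int (count (m - {#x, y#}) i) = ?f x y i" for i
        using xy(2) by (auto simp: of_nat_diff Suc_leI simp flip: count_greater_zero_iff)
      then have "m - {#x, y#} \<in> power_gens wheel_edges s"
        using m deg by (auto simp: Suc at_counts_def dest: in_diffD)
      moreover have "m = edge_mon {x, y} + (m - {#x, y#})"
        using mem xy(2) by (auto simp: edge_mon_doubleton multiset_eq_iff simp flip: count_greater_zero_iff)
      ultimately show ?thesis using xy(1) unfolding in_power_gens_Suc by blast
    qed
    have "{0,1} \<in> wheel_edges" "{1,2} \<in> wheel_edges" "{2,3} \<in> wheel_edges" "{3,4} \<in> wheel_edges"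
      "{0,4} \<in> wheel_edges" "{0,5} \<in> wheel_edges" "{1,5} \<in> wheel_edges" "{2,5} \<in> wheel_edges"
      "{3,5} \<in> wheel_edges" "{4,5} \<in> wheel_edges"
      unfolding wheel_edges_def by (simp_all only: insert_iff simp_thms)
    note removals = this[THEN remove, simplified]
    from wheel_degrees_remove_edge[OF deg_m[unfolded at_counts_def] of_nat_0_le_iff]
    show "m \<in> power_gens wheel_edges (Suc s)"
      using removals by (elim disjE) simp_all
  qed
qed

lemma inj_on_wheel_key: "inj_on (at_counts wheel_key) (power_gens wheel_edges s)"
proof (rule inj_onI)
  fix m n assume mn: "m \<in> power_gens wheel_edges s" "n \<in> power_gens wheel_edges s"
    and "at_counts wheel_key m = at_counts wheel_key n"
  then have "\<forall>i<6. count m i = count n i"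
    using wheel_key_inject unfolding all_less_6 power_gens_wheel mem_Collect_eq at_counts_def
    by (metis of_nat_eq_iff)
  moreover have "count m i = count n i" if "\<not> i < 6" for i
    using mn that unfolding power_gens_wheel by (metis (no_types, lifting) count_eq_zero_iff lessThan_iff mem_Collect_eq subsetD)
  ultimately show "m = n" by (metis multiset_eqI)
qed

lemma wheel_exchange:
  assumes "2 \<le> s" and u: "u \<in> power_gens wheel_edges s" and v: "v \<in> power_gens wheel_edges s"
    and less: "at_counts wheel_key v < at_counts wheel_key u"
  shows "\<exists>x y. count u x < count v x \<and> y \<in># u \<and> add_mset x (u - {#y#}) \<in> power_gens wheel_edges s \<and>
    at_counts wheel_key (add_mset x (u - {#y#})) < at_counts wheel_key u"
proof -
  let ?f = "\<lambda>x y i. int (count u i) + of_bool (i = x) - of_bool (i = y)"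
  have move: ?thesis
    if xy: "x \<noteq> y" "x < 6" "y < 6" "count u x < count v x"
      and deg: "wheel_degrees (int s) (?f x y 0) (?f x y 1) (?f x y 2) (?f x y 3) (?f x y 4) (?f x y 5)"
      and key: "wheel_key (?f x y 0) (?f x y 1) (?f x y 2) (?f x y 3) (?f x y 4) (?f x y 5)
        < at_counts wheel_key u"
    for x y
  proof -
    have "\<forall>i<6. 0 \<le> ?f x y i"
      using deg unfolding all_less_6 wheel_degrees_def by blast
    then have "0 \<le> ?f x y y" using xy by blast
    then have mem: "y \<in># u" using xy(1) by (auto simp flip: count_greater_zero_iff)
    then have "int (count (add_mset x (u - {#y#})) i) = ?f x y i" for i
      using xy(1) by (auto simp: of_nat_diff Suc_leI simp flip: count_greater_zero_iff)
    then have "at_counts g (add_mset x (u - {#y#})) =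
        g (?f x y 0) (?f x y 1) (?f x y 2) (?f x y 3) (?f x y 4) (?f x y 5)"
      for g :: "int \<Rightarrow> int \<Rightarrow> int \<Rightarrow> int \<Rightarrow> int \<Rightarrow> int \<Rightarrow> 'b"
      unfolding at_counts_def by presburger
    moreover have "set_mset (add_mset x (u - {#y#})) \<subseteq> {..<6}"
      using u xy(2) unfolding power_gens_wheel by (auto dest: in_diffD)
    ultimately show ?thesis
      using deg key xy(4) mem unfolding power_gens_wheel mem_Collect_eq by metis
  qed
  have degs: "at_counts (wheel_degrees (int s)) u" "at_counts (wheel_degrees (int s)) v"
    using u v unfolding power_gens_wheel by simp_all
  \<comment> \<open>The pairs are the moves \<open>u x/y\<close> of
    \<open>wheel_degrees_exchange\<close>, in the same order.\<close>
  note moves = move[of 0 3, simplified]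
    move[of 0 4, simplified]
    move[of 1 0, simplified]
    move[of 1 3, simplified]
    move[of 1 4, simplified]
    move[of 2 0, simplified]
    move[of 2 1, simplified]
    move[of 2 3, simplified]
    move[of 2 4, simplified]
    move[of 3 0, simplified]
    move[of 3 4, simplified]
    move[of 5 0, simplified]
    move[of 5 2, simplified]
    move[of 5 3, simplified]
  have "2 \<le> int s" using assms(1) by simp
  from wheel_degrees_exchange[OF degs[unfolded at_counts_def] this less[unfolded at_counts_def]]
  show ?thesis
    using moves by (elim disjE) (simp_all add: at_counts_def)
qed

section \<open>The blown-up wheel as a CDCC graph\<close>

lemma wheel_edges_iff:
  "{p, q} \<in> wheel_edges \<longleftrightarrow> (p, q) \<in> {(0,1),(1,2),(2,3),(3,4),(0,4),(0,5),(1,5),(2,5),(3,5),(4,5),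
     (1,0),(2,1),(3,2),(4,3),(4,0),(5,0),(5,1),(5,2),(5,3),(5,4)}"
  unfolding wheel_edges_def by (auto simp: doubleton_eq_iff)

text \<open>An edge at the hub is linked to any other edge by a spoke, and two disjoint edges of a
  5-cycle are linked by a third.\<close>

lemma gapfree_wheel: "gapfree wheel_edges"
  by code_simp

text \<open>Rim vertex 1 is the one multiplied. Its twin 6, present for \<open>n \<ge> 7\<close>,
  supplies the induced cricket and 4-cycle that the wheel itself lacks.\<close>

definition twin_vertex :: "nat \<Rightarrow> nat" where
  "twin_vertex x = (if x < 6 then x else 1)"

lemma atLeast0LessThan_5: "{0..<5::nat} = {0,1,2,3,4}" by auto
lemma atLeast0LessThan_4: "{0..<4::nat} = {0,1,2,3}" by auto

lemma CDCC_blowup_wheel: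
  assumes "7 \<le> n"
  shows "CDCC {..<n} (blowup {..<n} twin_vertex wheel_edges)"
proof -
  note simps = atLeast0LessThan_5 atLeast0LessThan_4 adj_blowup twin_vertex_def wheel_edges_iff doubleton_eq_iff
  let ?E = "blowup {..<n} twin_vertex wheel_edges"
  \<comment> \<open>The centre is the hub; the twins 1 and 6 are adjacent to neither end of the rim
    edge \<open>{3, 4}\<close>.\<close>
  have "has_induced {..<n} ?E {0..<5} cricket_edges"
    unfolding has_induced_def cricket_edges_def
    using assms by (intro exI[of _ "\<lambda>i. [5, 3, 4, 1, 6] ! i"]) (simp add: simps)
  moreover have "has_induced {..<n} ?E {0..<4} diamond_edges"
    unfolding has_induced_def diamond_edges_def
    using assms by (intro exI[of _ "\<lambda>i. [5, 2, 1, 3] ! i"]) (simp add: simps)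
  \<comment> \<open>The twins 1 and 6 are opposite corners, and 0 and 2 are their common rim
    neighbours.\<close>
  moreover have "has_induced {..<n} ?E {0..<4} C4_edges"
    unfolding has_induced_def C4_edges_def
    using assms by (intro exI[of _ "\<lambda>i. [1, 2, 6, 0] ! i"]) (simp add: simps)
  moreover have "has_induced {..<n} ?E {0..<5} C5_edges"
    unfolding has_induced_def C5_edges_def
    using assms by (intro exI[of _ "\<lambda>i. i"]) (simp add: simps)
  ultimately show ?thesis
    unfolding CDCC_def
    using simple_graph_blowup[OF _ card_wheel_edges] gapfree_blowup[OF card_wheel_edges gapfree_wheel] by auto
qed

theorem theorem5p7:
  shows "\<forall>n::nat. n \<ge> 7 \<longrightarrow>
    (\<exists>(V::nat set) (E::nat set set). card V = n \<and> CDCC V E \<and>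
       (\<forall>s::nat. s \<ge> 2 \<longrightarrow> linear_quotients V (power_gens E s)))"
proof (intro allI impI)
  fix n :: nat assume n: "7 \<le> n"
  let ?E = "blowup {..<n} twin_vertex wheel_edges"
  have "linear_quotients {..<n} (power_gens ?E s)" if "2 \<le> s" for s
    using linear_quotients_power_blowup[OF card_wheel_edges finite_lessThan inj_on_wheel_key wheel_exchange[OF that]] .
  then show "\<exists>(V::nat set) E. card V = n \<and> CDCC V E \<and> (\<forall>s\<ge>2. linear_quotients V (power_gens E s))"
    using CDCC_blowup_wheel[OF n] card_lessThan by metis
qed

end
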